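(* Let $\mathcal{L}=(L,\vee,\wedge,\odot,\rightarrow,0,1)$ be a complete residuated lattice satisfying the double negation law. Then $\mathbf{S}(\mathcal{L}):=(L,\vee,\odot,0,1)$ is a DNL-semiring (with $\vee$ as addition and $\odot$ as multiplication).
   Context: A semiring is an algebra $(S,+,\cdot,0,1)$ of type $(2,2,0,0)$ such that $(S,+,0)$ is a commutative monoid, $(S,\cdot,1)$ is a monoid, $(x+y)\cdot z=x\cdot z+y\cdot z$ and $x\cdot(y+z)=x\cdot y+x\cdot z$, and $x\cdot 0=0\cdot x=0$, for all $x,y,z\in S$. It is called idempotent if $x+x=x$ for all $x$, commutative if $x\cdot y=y\cdot x$ for all $x,y$, and simple if $x+1=1$ for all $x$. If the semiring is idempotent, $(S,+)$ is a join-semilattice with induced order $a\leq b$ iff $a+b=b$, and $\sum$ over a family denotes its supremum with respect to $\leq$. A DNL-semiring is a commutative idempotent simple semiring $(S,+,\cdot,0,1)$ such that $(S,+)$ is a complete join-semilattice (every subset of $S$ has a supremum) and such that, with $n(x):=\sum_{x\cdot y=0}y$ (the supremum of $\{y\in S\mid x\cdot y=0\}$), the following hold for all $x,y\in S$: (i) $n(n(x))=x$; (ii) $x\cdot n(x\cdot n(y))\leq y$; (iii) $x\cdot n(x+y)=0$. A residuated lattice is an algebra $(L,\vee,\wedge,\odot,\rightarrow,0,1)$ of type $(2,2,2,2,0,0)$ such that $(L,\vee,\wedge,0,1)$ is a bounded lattice (with least element $0$ and greatest element $1$), $(L,\odot,1)$ is a commutative monoid, and for all $x,y,z\in L$: $x\odot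 y\leq z$ if and only if $x\leq y\rightarrow z$, where $\leq$ is the lattice order. It is complete if its lattice is complete. With $\neg x:=x\rightarrow 0$, it satisfies the double negation law if $\neg(\neg x)=x$ for all $x\in L$. *)

theory Defs
  imports "HOL-Algebra.Ring" "HOL-Algebra.Complete_Lattice"
begin

text \<open>The order \<open>a \<le> b \<longleftrightarrow> a + b = b\<close>. It serves both for idempotent semirings and for lattices,
  whose join is stored in the field \<^const>\<open>add\<close>.\<close>

definition induced_order :: "('a, 'm) ring_scheme \<Rightarrow> 'a gorder" where
  "induced_order R =
     \<lparr> carrier = carrier R, eq = (=), le = (\<lambda>x y. x \<oplus>\<^bsub>R\<^esub> y = y) \<rparr>"

abbreviation ileq :: "('a, 'm) ring_scheme \<Rightarrow> 'a \<Rightarrow> 'a \<Rightarrow> bool"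
  ("(_/ \<preceq>\<index> _)" [51, 51] 50) where
  "x \<preceq>\<^bsub>R\<^esub> y \<equiv> x \<sqsubseteq>\<^bsub>induced_order R\<^esub> y"

locale idempotent_semiring = semiring R for R (structure) +
  assumes add_idem: "x \<in> carrier R \<Longrightarrow> x \<oplus> x = x"

locale commutative_semiring = semiring R + comm_monoid R for R (structure)

locale simple_semiring = semiring R for R (structure) +
  assumes add_one: "x \<in> carrier R \<Longrightarrow> x \<oplus> \<one> = \<one>"

definition ann_sup :: "('a, 'm) ring_scheme \<Rightarrow> 'a \<Rightarrow> 'a" where
  "ann_sup R x = \<Squnion>\<^bsub>induced_order R\<^esub> {y \<in> carrier R. x \<otimes>\<^bsub>R\<^esub> y = \<zero>\<^bsub>R\<^esub>}"

locale DNL_semiring =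
  commutative_semiring R + idempotent_semiring R + simple_semiring R for R (structure) +
  assumes sup_exists:
      "A \<subseteq> carrier R \<Longrightarrow> \<exists>s. least (induced_order R) s (Upper (induced_order R) A)"
    and ann_sup_involutive:
      "x \<in> carrier R \<Longrightarrow> ann_sup R (ann_sup R x) = x"
    and mult_ann_sup_le:
      "\<lbrakk> x \<in> carrier R; y \<in> carrier R \<rbrakk> \<Longrightarrow> x \<otimes> ann_sup R (x \<otimes> ann_sup R y) \<preceq> y"
    and mult_ann_sup_add:
      "\<lbrakk> x \<in> carrier R; y \<in> carrier R \<rbrakk> \<Longrightarrow> x \<otimes> ann_sup R (x \<oplus> y) = \<zero>"

text \<open>An algebra \<open>(L, \<or>, \<and>, \<odot>, \<rightarrow>, 0, 1)\<close> is stored with \<open>\<or>\<close> as \<^const>\<open>add\<close>,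
  \<open>\<odot>\<close> as \<^const>\<open>mult\<close>, and \<open>0\<close>, \<open>1\<close> as \<^const>\<open>zero\<close>, \<^const>\<open>one\<close>.
  The record type alone imposes no ring laws.\<close>

record 'a rl_algebra = "'a ring" +
  wedge :: "'a \<Rightarrow> 'a \<Rightarrow> 'a" (infixl "\<triangle>\<index>" 70)
  residuum :: "'a \<Rightarrow> 'a \<Rightarrow> 'a" (infixr "\<rightharpoonup>\<index>" 60)

locale residuated_lattice = comm_monoid L for L (structure) +
  assumes join_closed: "\<lbrakk> x \<in> carrier L; y \<in> carrier L \<rbrakk> \<Longrightarrow> x \<oplus> y \<in> carrier L"
    and wedge_closed: "\<lbrakk> x \<in> carrier L; y \<in> carrier L \<rbrakk> \<Longrightarrow> x \<triangle> y \<in> carrier L"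
    and residuum_closed: "\<lbrakk> x \<in> carrier L; y \<in> carrier L \<rbrakk> \<Longrightarrow> x \<rightharpoonup> y \<in> carrier L"
    and zero_closed: "\<zero> \<in> carrier L"
    and join_comm: "\<lbrakk> x \<in> carrier L; y \<in> carrier L \<rbrakk> \<Longrightarrow> x \<oplus> y = y \<oplus> x"
    and wedge_comm: "\<lbrakk> x \<in> carrier L; y \<in> carrier L \<rbrakk> \<Longrightarrow> x \<triangle> y = y \<triangle> x"
    and join_assoc:
      "\<lbrakk> x \<in> carrier L; y \<in> carrier L; z \<in> carrier L \<rbrakk> \<Longrightarrow> (x \<oplus> y) \<oplus> z = x \<oplus> (y \<oplus> z)"
    and wedge_assoc:
      "\<lbrakk> x \<in> carrier L; y \<in> carrier L; z \<in> carrier L \<rbrakk> \<Longrightarrow> (x \<triangle> y) \<triangle> z = x \<triangle> (y \<triangle> z)"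
    and join_wedge_absorb: "\<lbrakk> x \<in> carrier L; y \<in> carrier L \<rbrakk> \<Longrightarrow> x \<oplus> (x \<triangle> y) = x"
    and wedge_join_absorb: "\<lbrakk> x \<in> carrier L; y \<in> carrier L \<rbrakk> \<Longrightarrow> x \<triangle> (x \<oplus> y) = x"
    and zero_le: "x \<in> carrier L \<Longrightarrow> \<zero> \<preceq> x"
    and le_one: "x \<in> carrier L \<Longrightarrow> x \<preceq> \<one>"
    and residuation:
      "\<lbrakk> x \<in> carrier L; y \<in> carrier L; z \<in> carrier L \<rbrakk> \<Longrightarrow> x \<otimes> y \<preceq> z \<longleftrightarrow> x \<preceq> y \<rightharpoonup> z"

locale complete_residuated_lattice = residuated_lattice L for L (structure) +
  assumes complete: "complete_lattice (induced_order L)"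

definition rneg :: "('a, 'm) rl_algebra_scheme \<Rightarrow> 'a \<Rightarrow> 'a" where
  "rneg L x = x \<rightharpoonup>\<^bsub>L\<^esub> \<zero>\<^bsub>L\<^esub>"

definition double_negation_law :: "('a, 'm) rl_algebra_scheme \<Rightarrow> bool" where
  "double_negation_law L \<longleftrightarrow> (\<forall>x \<in> carrier L. rneg L (rneg L x) = x)"

definition semiring_of :: "('a, 'm) rl_algebra_scheme \<Rightarrow> 'a ring" where
  "semiring_of L =
     \<lparr> carrier = carrier L, mult = mult L, one = one L, zero = zero L, add = add L \<rparr>"

end

theory Submission
  imports Defs
begin

text \<open>Residuation makes \<open>\<odot>\<close> distribute over \<open>\<or>\<close>, and it says that \<open>\<not> x\<close> is the greatest
  element annihilating \<open>x\<close>, so that \<open>n x = \<not> x\<close>. Since \<open>y = \<not> \<not> y\<close>, condition (ii) is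
  equivalent to \<open>(x \<odot> \<not> y) \<odot> \<not> (x \<odot> \<not> y) = 0\<close>.\<close>

context residuated_lattice
begin

lemma le_iff: "x \<preceq> y \<longleftrightarrow> x \<oplus> y = y"
  by (simp add: induced_order_def)

text \<open>Idempotence comes from the two absorption laws:
  \<open>x \<triangle> (x \<oplus> x) = x\<close>, and joining \<open>x\<close> with that meet
  returns \<open>x\<close>.\<close>

lemma join_idem: "x \<in> carrier L \<Longrightarrow> x \<oplus> x = x"
  by (metis join_closed join_wedge_absorb wedge_join_absorb)

lemma le_refl: "x \<in> carrier L \<Longrightarrow> x \<preceq> x"
  by (simp add: le_iff join_idem)

lemma le_antisym: "\<lbrakk> x \<preceq> y; y \<preceq> x; x \<in> carrier L; y \<in> carrier L \<rbrakk> \<Longrightarrow> x = y"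
  by (metis le_iff join_comm)

lemma le_trans:
  "\<lbrakk> x \<preceq> y; y \<preceq> z; x \<in> carrier L; y \<in> carrier L; z \<in> carrier L \<rbrakk> \<Longrightarrow> x \<preceq> z"
  by (metis le_iff join_assoc)

lemma join_upper1: "\<lbrakk> x \<in> carrier L; y \<in> carrier L \<rbrakk> \<Longrightarrow> x \<preceq> x \<oplus> y"
  by (metis le_iff join_assoc join_idem)

lemma join_upper2: "\<lbrakk> x \<in> carrier L; y \<in> carrier L \<rbrakk> \<Longrightarrow> y \<preceq> x \<oplus> y"
  by (metis join_comm join_upper1)

lemma join_le_iff:
  assumes "x \<in> carrier L" "y \<in> carrier L" "z \<in> carrier L"
  shows "x \<oplus> y \<preceq> z \<longleftrightarrow> x \<preceq> z \<and> y \<preceq> z"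
proof
  assume "x \<oplus> y \<preceq> z"
  then show "x \<preceq> z \<and> y \<preceq> z"
    using assms by (meson join_closed join_upper1 join_upper2 le_trans)
next
  assume "x \<preceq> z \<and> y \<preceq> z"
  then show "x \<oplus> y \<preceq> z"
    using assms by (simp add: le_iff join_assoc)
qed

lemma zero_join: "x \<in> carrier L \<Longrightarrow> \<zero> \<oplus> x = x"
  using zero_le by (simp add: le_iff)

lemma join_one: "x \<in> carrier L \<Longrightarrow> x \<oplus> \<one> = \<one>"
  using le_one by (simp add: le_iff)

lemma le_zero_iff: "x \<in> carrier L \<Longrightarrow> x \<preceq> \<zero> \<longleftrightarrow> x = \<zero>"
  using le_antisym le_refl zero_le zero_closed by blast

text \<open>By residuation, the trivial inequality
  \<open>\<zero> \<preceq> x \<rightharpoonup> \<zero>\<close> becomes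
  \<open>\<zero> \<otimes> x \<preceq> \<zero>\<close>.\<close>

lemma zero_mult: "x \<in> carrier L \<Longrightarrow> \<zero> \<otimes> x = \<zero>"
  using le_zero_iff [of "\<zero> \<otimes> x"] residuation [of \<zero> x \<zero>]
  by (simp add: residuum_closed zero_closed zero_le)

text \<open>Each side unfolds by residuation to \<open>x \<preceq> z \<rightharpoonup> w\<close>
  together with \<open>y \<preceq> z \<rightharpoonup> w\<close>. So the two products have the same
  upper bounds, and distributivity follows by taking \<open>w\<close> to be either of them.\<close>

lemma join_mult_le_iff:
  assumes "x \<in> carrier L" "y \<in> carrier L" "z \<in> carrier L" "w \<in> carrier L"
  shows "(x \<oplus> y) \<otimes> z \<preceq> w \<longleftrightarrow> x \<otimes> z \<oplus> y \<otimes> z \<preceq> w"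
  using assms by (simp add: residuation join_le_iff join_closed residuum_closed)

lemma join_mult_distrib:
  assumes "x \<in> carrier L" "y \<in> carrier L" "z \<in> carrier L"
  shows "(x \<oplus> y) \<otimes> z = x \<otimes> z \<oplus> y \<otimes> z"
proof (rule le_antisym)
  show "(x \<oplus> y) \<otimes> z \<preceq> x \<otimes> z \<oplus> y \<otimes> z"
    using assms by (simp add: join_mult_le_iff join_closed le_refl)
  show "x \<otimes> z \<oplus> y \<otimes> z \<preceq> (x \<oplus> y) \<otimes> z"
    using assms by (simp add: join_mult_le_iff [symmetric] join_closed le_refl)
qed (use assms in \<open>simp_all add: join_closed\<close>)

lemma rneg_closed: "x \<in> carrier L \<Longrightarrow> rneg L x \<in> carrier L"
  by (simp add: rneg_def residuum_closed zero_closed)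

text \<open>This is residuation with \<open>\<zero>\<close> as the bound; commutativity puts
  \<open>x\<close> on the left.\<close>

lemma le_rneg_iff:
  "\<lbrakk> x \<in> carrier L; y \<in> carrier L \<rbrakk> \<Longrightarrow> y \<preceq> rneg L x \<longleftrightarrow> x \<otimes> y = \<zero>"
  unfolding rneg_def by (metis le_zero_iff m_closed m_comm residuation zero_closed)

lemma mult_rneg: "x \<in> carrier L \<Longrightarrow> x \<otimes> rneg L x = \<zero>"
  using le_refl le_rneg_iff rneg_closed by blast

lemma join_mult_rneg:
  assumes "x \<in> carrier L" "y \<in> carrier L"
  shows "x \<otimes> rneg L (x \<oplus> y) = \<zero>"
proof -
  \<comment> \<open>Distributivity makes multiplication monotone: the left side is one summand of
    the right side, which vanishes.\<close>
  have "x \<otimes> rneg L (x \<oplus> y) \<preceq> (x \<oplus> y) \<otimes> rneg L (x \<oplus> y)"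
    using assms by (simp add: join_mult_distrib join_upper1 join_closed rneg_closed)
  then show ?thesis
    using assms by (simp add: mult_rneg le_zero_iff join_closed rneg_closed)
qed

lemma mult_rneg_mult_rneg_le:
  assumes "double_negation_law L" "x \<in> carrier L" "y \<in> carrier L"
  shows "x \<otimes> rneg L (x \<otimes> rneg L y) \<preceq> y"
proof -
  let ?n = "rneg L (x \<otimes> rneg L y)"
  have n: "?n \<in> carrier L" "rneg L y \<in> carrier L"
    using assms by (simp_all add: rneg_closed)
  \<comment> \<open>By \<open>le_rneg_iff\<close>, an element lies below
    \<open>rneg L (rneg L y)\<close> exactly when \<open>rneg L y\<close> annihilates it.\<close>
  have "rneg L y \<otimes> (x \<otimes> ?n) = (x \<otimes> rneg L y) \<otimes> ?n"
    using assms n by (simp add: m_ac)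
  also have "\<dots> = \<zero>"
    using assms n by (simp add: mult_rneg)
  finally have "x \<otimes> ?n \<preceq> rneg L (rneg L y)"
    using assms n by (simp add: le_rneg_iff)
  then show ?thesis
    using assms by (simp add: double_negation_law_def)
qed

end

text \<open>The supremum is attained: \<open>rneg L x\<close> annihilates \<open>x\<close> and
  bounds every element that does.\<close>

lemma (in complete_residuated_lattice) ann_sup_eq_rneg:
  assumes "x \<in> carrier L"
  shows "ann_sup L x = rneg L x"
proof -
  interpret complete_lattice "induced_order L"
    by (rule complete)
  let ?A = "{y \<in> carrier L. x \<otimes> y = \<zero>}"
  have carr: "carrier (induced_order L) = carrier L"
    by (simp add: induced_order_def)
  have "least (induced_order L) (rneg L x) (Upper (induced_order L) ?A)"
    using assms
    by (intro least_UpperI) (auto simp: carr le_rneg_iff mult_rneg rneg_closed Upper_def)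
  \<comment> \<open>\<open>sup\<close> is a Hilbert choice of a least upper bound, so uniqueness of
    least elements is what identifies it.\<close>
  then show ?thesis
    unfolding ann_sup_def sup_def using least_unique by blast
qed

lemma semiring_of_simps [simp]:
  "carrier (semiring_of L) = carrier L"
  "mult (semiring_of L) = mult L"
  "one (semiring_of L) = one L"
  "zero (semiring_of L) = zero L"
  "add (semiring_of L) = add L"
  by (simp_all add: semiring_of_def)

text \<open>The order depends on \<open>carrier\<close> and \<open>add\<close> alone, so suprema in
  the reduct are suprema in \<open>L\<close>.\<close>

lemma induced_order_semiring_of [simp]: "induced_order (semiring_of L) = induced_order L"
  by (simp add: induced_order_def)

lemma ann_sup_semiring_of [simp]: "ann_sup (semiring_of L) = ann_sup L"
  by (simp add: ann_sup_def fun_eq_iff)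

lemma (in residuated_lattice) semiring_semiring_of: "semiring (semiring_of L)"
proof -
  have "x \<oplus> \<zero> = x" if "x \<in> carrier L" for x
    using that zero_join join_comm zero_closed by simp
  \<comment> \<open>Left commutativity lets the final simplification normalise joins modulo
    associativity and commutativity.\<close>
  moreover have "x \<oplus> (y \<oplus> z) = y \<oplus> (x \<oplus> z)"
    if "x \<in> carrier L" "y \<in> carrier L" "z \<in> carrier L" for x y z
    using that by (metis join_assoc join_comm)
  moreover have "x \<otimes> \<zero> = \<zero>" if "x \<in> carrier L" for x
    using that zero_mult m_comm zero_closed by simp
  moreover have "z \<otimes> (x \<oplus> y) = z \<otimes> x \<oplus> z \<otimes> y"
    if "x \<in> carrier L" "y \<in> carrier L" "z \<in> carrier L" for x y z
    using that join_mult_distrib m_comm join_closed by simp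
  ultimately show ?thesis
    by unfold_locales
      (simp_all add: join_closed join_assoc join_comm zero_closed zero_join zero_mult
        join_mult_distrib m_assoc)
qed

theorem theorem15:
  fixes L :: "'a rl_algebra"
  assumes "complete_residuated_lattice L"
    and "double_negation_law L"
  shows "DNL_semiring (semiring_of L)"
proof -
  interpret complete_residuated_lattice L by fact
  \<comment> \<open>With this interpretation in place, \<open>unfold_locales\<close> leaves only the
    axioms beyond those of a semiring.\<close>
  interpret S: semiring "semiring_of L" by (rule semiring_semiring_of)
  have carr: "carrier (induced_order L) = carrier L"
    by (simp add: induced_order_def)
  show ?thesis
  proof unfold_locales
    fix x y assume "x \<in> carrier (semiring_of L)" "y \<in> carrier (semiring_of L)"
    then show "x \<otimes>\<^bsub>semiring_of L\<^esub> y = y \<otimes>\<^bsub>semiring_of L\<^esub> x"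
      by (simp add: m_comm)
  next
    fix A assume "A \<subseteq> carrier (semiring_of L)"
    then show "\<exists>s. least (induced_order (semiring_of L)) s (Upper (induced_order (semiring_of L)) A)"
      using complete_lattice.sup_exists [OF complete] by (simp add: carr)
  \<comment> \<open>Once \<open>ann_sup\<close> is rewritten to \<open>rneg\<close>, condition (i)
    is the double negation law itself.\<close>
  qed (use assms(2) in \<open>simp_all add: join_idem join_one ann_sup_eq_rneg rneg_closed join_closed
      join_mult_rneg mult_rneg_mult_rneg_le double_negation_law_def\<close>)
qed

end
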